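(* Let $E$ be a finite-dimensional real vector space, $Q\subset E$ nonempty, convex and compact, and $h:Q\to\mathbb{R}$ concave and differentiable on $Q$, with finite curvature constant $C_{h,Q}$. Fix an integer $k\ge1$ and run the Frank-Wolfe method initiated with the pre-start step and with constant step-sizes $\bar\alpha_i=\bar\alpha^*:=1-\frac{1}{\sqrt[k]{k+1}}$ for all iterations $i\ge1$. Then after $k$ iterations: $$B_k-h(\lambda_{k+1})\le\frac{\frac12C_{h,Q}\left(1+\ln(k+1)\right)}{k}.$$ Furthermore, after $2k+1$ iterations: $$\min_{i\in\{1,\ldots,2k+1\}}G_i\le\frac{\frac12C_{h,Q}\left(1+2\ln(k+1)\right)}{k}.$$
   Context: Notation: $E^*$ is the dual space of $E$, $s^T\lambda$ is the evaluation of $s\in E^*$ at $\lambda\in E$, $\nabla h(\lambda)\in E^*$, and $h^*=\max_{\lambda\in Q}h(\lambda)$. Curvature constant: $C_{h,Q}$ is the minimal $C$ such that $h(\lambda+\alpha(\bar\lambda-\lambda))\ge h(\lambda)+\nabla h(\lambda)^T(\alpha(\bar\lambda-\lambda))-\frac12 C\alpha^2$ for all $\lambda,\bar\lambda\in Q$ and all $\alpha\in[0,1]$ (assumed finite). Pre-start step: given $\lambda_0\in Q$ and an upper bound $B_{-1}\ge h^*$ (possibly $+\infty$), choose $\tilde\lambda_0\in\arg\max_{\lambda\in Q}\{h(\lambda_0)+\nabla h(\lambda_0)^T(\lambda-\lambda_0)\}$, set $B^w_0=h(\lambda_0)+\nabla h(\lambda_0)^T(\tilde\lambda_0-\lambda_0)$,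 $B_0=\min\{B_{-1},B^w_0,B^o_0\}$, and $\lambda_1=\tilde\lambda_0$. Frank-Wolfe method: at iteration $i\ge1$, choose $\tilde\lambda_i\in\arg\max_{\lambda\in Q}\{h(\lambda_i)+\nabla h(\lambda_i)^T(\lambda-\lambda_i)\}$; set $B^w_i=h(\lambda_i)+\nabla h(\lambda_i)^T(\tilde\lambda_i-\lambda_i)$ and the FW gap $G_i=\nabla h(\lambda_i)^T(\tilde\lambda_i-\lambda_i)$; set $B_i=\min\{B_{i-1},B^w_i,B^o_i\}$; set $\lambda_{i+1}=\lambda_i+\bar\alpha_i(\tilde\lambda_i-\lambda_i)$. Here each $B^o_i\ge h^*$ ($i\ge0$) is any other (optional) upper bound on $h^*$ (omitted, or $+\infty$, if not computed). *)

theory Defs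
  imports "HOL-Analysis.Analysis"
begin

text \<open>
  Throughout, \<open>h' x\<close> is the gradient of \<open>h\<close> at \<open>x\<close>, viewed as an element of the dual space: a linear
  functional with \<open>(h has_derivative h' x) (at x within Q)\<close>. If \<open>Q\<close> has empty interior, this
  functional is determined only on the directions \<open>y - x\<close> with \<open>y \<in> Q\<close>; no other directions are used.
\<close>

definition linearization :: "('a::real_normed_vector \<Rightarrow> real) \<Rightarrow> ('a \<Rightarrow> 'a \<Rightarrow> real) \<Rightarrow> 'a \<Rightarrow> 'a \<Rightarrow> real"
  where "linearization h h' x y = h x + h' x (y - x)"

definition curvature_bound ::
    "('a::real_normed_vector \<Rightarrow> real) \<Rightarrow> ('a \<Rightarrow> 'a \<Rightarrow> real) \<Rightarrow> 'a set \<Rightarrow> real \<Rightarrow> bool"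
  where "curvature_bound h h' Q C \<longleftrightarrow>
    (\<forall>x\<in>Q. \<forall>y\<in>Q. \<forall>\<alpha>\<in>{0..1}.
       h (x + \<alpha> *\<^sub>R (y - x)) \<ge> h x + h' x (\<alpha> *\<^sub>R (y - x)) - 1 / 2 * C * \<alpha>\<^sup>2)"

text \<open>Finiteness of the curvature constant means that some curvature bound exists.\<close>

definition finite_curvature ::
    "('a::real_normed_vector \<Rightarrow> real) \<Rightarrow> ('a \<Rightarrow> 'a \<Rightarrow> real) \<Rightarrow> 'a set \<Rightarrow> bool"
  where "finite_curvature h h' Q \<longleftrightarrow> (\<exists>C. curvature_bound h h' Q C)"

definition curvature_const ::
    "('a::real_normed_vector \<Rightarrow> real) \<Rightarrow> ('a \<Rightarrow> 'a \<Rightarrow> real) \<Rightarrow> 'a set \<Rightarrow> real"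
  where "curvature_const h h' Q = (LEAST C. curvature_bound h h' Q C)"

definition opt_value :: "('a::real_normed_vector \<Rightarrow> real) \<Rightarrow> 'a set \<Rightarrow> real"
  where "opt_value h Q = (SUP x\<in>Q. h x)"

text \<open>The least curvature bound and the maximum exist under the standing assumptions.\<close>

lemma curvature_bound_curvature_const:
  assumes "Q \<noteq> {}" and lin: "\<And>x. x \<in> Q \<Longrightarrow> linear (h' x)" and fin: "finite_curvature h h' Q"
  shows "curvature_bound h h' Q (curvature_const h h' Q)"
proof -
  let ?S = "{C. curvature_bound h h' Q C}"
  obtain a where a: "a \<in> Q" using assms(1) by blast
  have nonneg: "C \<ge> 0" if "curvature_bound h h' Q C" for C
  proof -
    have "h (a + 1 *\<^sub>R (a - a)) \<ge> h a + h' a (1 *\<^sub>R (a - a)) - 1 / 2 * C * 1\<^sup>2"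
      using that a unfolding curvature_bound_def by (meson atLeastAtMost_iff order_refl zero_le_one)
    then show ?thesis using linear_0[OF lin[OF a]] by simp
  qed
  have bdd: "bdd_below ?S" using nonneg by (intro bdd_belowI[of _ 0]) simp
  have ne: "?S \<noteq> {}" using fin by (simp add: finite_curvature_def)
  have bnd: "curvature_bound h h' Q (Inf ?S)"
  proof (subst curvature_bound_def, intro ballI)
    fix x y and \<alpha> :: real
    assume xy: "x \<in> Q" "y \<in> Q" "\<alpha> \<in> {0..1}"
    define D where "D = 2 * (h x + h' x (\<alpha> *\<^sub>R (y - x)) - h (x + \<alpha> *\<^sub>R (y - x)))"
    have D: "D \<le> C * \<alpha>\<^sup>2" if "curvature_bound h h' Q C" for C
      using that xy unfolding curvature_bound_def D_def by fastforce
    have "D \<le> Inf ?S * \<alpha>\<^sup>2"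
    proof (cases "\<alpha> = 0")
      case True
      then show ?thesis using D ne by auto
    next
      case False
      then have "D / \<alpha>\<^sup>2 \<le> C" if "C \<in> ?S" for C
        using D that by (simp add: divide_le_eq)
      then have "D / \<alpha>\<^sup>2 \<le> Inf ?S" using ne by (intro cInf_greatest)
      then show ?thesis using False by (simp add: divide_le_eq)
    qed
    then show "h (x + \<alpha> *\<^sub>R (y - x)) \<ge> h x + h' x (\<alpha> *\<^sub>R (y - x)) - 1 / 2 * Inf ?S * \<alpha>\<^sup>2"
      unfolding D_def by argo
  qed
  have "curvature_const h h' Q = Inf ?S"
    unfolding curvature_const_def
    using bnd bdd by (intro Least_equality) (auto intro: cInf_lower)
  then show ?thesis using bnd by simp
qed

lemma opt_value_is_max:
  assumes "Q \<noteq> {}" "compact Q" "continuous_on Q h"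
  shows "opt_value h Q \<in> h ` Q" "\<And>x. x \<in> Q \<Longrightarrow> h x \<le> opt_value h Q"
proof -
  obtain m where m: "m \<in> Q" "\<And>x. x \<in> Q \<Longrightarrow> h x \<le> h m"
    using continuous_attains_sup[OF assms(2,1,3)] by blast
  then have "opt_value h Q = h m"
    unfolding opt_value_def by (auto intro!: cSup_eq_maximum)
  then show "opt_value h Q \<in> h ` Q" "\<And>x. x \<in> Q \<Longrightarrow> h x \<le> opt_value h Q"
    using m by auto
qed

definition wolfe_bound :: "('a::real_normed_vector \<Rightarrow> real) \<Rightarrow> ('a \<Rightarrow> 'a \<Rightarrow> real) \<Rightarrow> 'a \<Rightarrow> 'a \<Rightarrow> real"
  where "wolfe_bound h h' x xt = linearization h h' x xt"

definition fw_gap :: "('a::real_normed_vector \<Rightarrow> 'a \<Rightarrow> real) \<Rightarrow> 'a \<Rightarrow> 'a \<Rightarrow> real"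
  where "fw_gap h' x xt = h' x (xt - x)"

text \<open>
  A run of the Frank-Wolfe method initiated with the pre-start step: \<open>lam\<close> are the iterates, \<open>lamt\<close>
  the maximizers of the linearizations, \<open>\<alpha> i\<close> (\<open>i \<ge> 1\<close>) the step-sizes, \<open>B\<close> the upper bounds,
  \<open>Binit\<close> the initial bound of index \<open>-1\<close>, and \<open>Bo\<close> the optional bounds, where \<open>\<infinity>\<close> means that
  none is computed.
\<close>

definition frank_wolfe_prestart ::
    "('a::real_normed_vector \<Rightarrow> real) \<Rightarrow> ('a \<Rightarrow> 'a \<Rightarrow> real) \<Rightarrow> 'a set \<Rightarrow> (nat \<Rightarrow> real) \<Rightarrow>
     ereal \<Rightarrow> (nat \<Rightarrow> ereal) \<Rightarrow> (nat \<Rightarrow> 'a) \<Rightarrow> (nat \<Rightarrow> 'a) \<Rightarrow> (nat \<Rightarrow> ereal) \<Rightarrow> bool"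
  where "frank_wolfe_prestart h h' Q \<alpha> Binit Bo lam lamt B \<longleftrightarrow>
    lam 0 \<in> Q \<and>
    Binit \<ge> ereal (opt_value h Q) \<and>
    (\<forall>i. Bo i \<ge> ereal (opt_value h Q)) \<and>
    (\<forall>i. is_arg_max (linearization h h' (lam i)) (\<lambda>x. x \<in> Q) (lamt i)) \<and>
    B 0 = Min {Binit, ereal (wolfe_bound h h' (lam 0) (lamt 0)), Bo 0} \<and>
    lam 1 = lamt 0 \<and>
    (\<forall>i\<ge>1. B i = Min {B (i - 1), ereal (wolfe_bound h h' (lam i) (lamt i)), Bo i}) \<and>
    (\<forall>i\<ge>1. lam (i + 1) = lam i + \<alpha> i *\<^sub>R (lamt i - lam i))"

end

(* Each step satisfies h_(i+1) >= h_i + a G_i - C a^2 / 2 with a the constant step-size, and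
   B_k <= B_i <= h_i + G_i for i <= k, so the gaps e_i = B_k - h_i obey
   e_(i+1) <= (1 - a) e_i + C a^2 / 2. The pre-start step is a full step, hence e_1 <= C / 2. Since
   (1 - a)^k = 1 / (k + 1), unrolling gives e_(k+1) <= (C / 2) (1 + k a) / (k + 1), and
   k a <= ln (k + 1). For the FW gaps, the step inequalities of the iterations k + 1, ..., 2 k + 1
   are summed: the total increase of h is at most e_(k+1), because B_k is an upper bound on h. *)

theory Submission
  imports Defs
begin

text \<open>Along the segment from \<open>x\<close> to \<open>y\<close>, which stays in
  \<open>Q\<close>, concavity makes every difference quotient of \<open>h\<close> at
  \<open>x\<close> at least \<open>h y - h x\<close>, and these quotients tend to
  \<open>D (y - x)\<close>.\<close>

lemma concave_on_has_derivative_le: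
  fixes h :: "'a::real_normed_vector \<Rightarrow> real"
  assumes conc: "concave_on Q h" and x: "x \<in> Q" and y: "y \<in> Q"
    and der: "(h has_derivative D) (at x within Q)"
  shows "h y \<le> h x + D (y - x)"
proof -
  define g where "g t = x + t *\<^sub>R (y - x)" for t :: real
  have cvx: "convex Q" using conc by (simp add: concave_on_iff)
  have g_eq: "g t = (1 - t) *\<^sub>R x + t *\<^sub>R y" for t
    by (simp add: g_def algebra_simps)
  have gQ: "g ` {0..1} \<subseteq> Q"
    using cvx x y by (auto simp: g_eq convex_alt)
  have "(g has_derivative (\<lambda>t. t *\<^sub>R (y - x))) (at 0 within {0..1})"
    unfolding g_def by (auto intro!: derivative_eq_intros)
  moreover have "(h has_derivative D) (at (g 0) within g ` {0..1})"
    using has_derivative_subset[OF der gQ] by (simp add: g_def)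
  ultimately have "((h \<circ> g) has_derivative (D \<circ> (\<lambda>t. t *\<^sub>R (y - x)))) (at 0 within {0..1})"
    by (rule diff_chain_within)
  moreover have "D \<circ> (\<lambda>t. t *\<^sub>R (y - x)) = (*) (D (y - x))"
    using linear_scale[OF has_derivative_linear[OF der]] by (auto simp: fun_eq_iff)
  ultimately have "((h \<circ> g) has_field_derivative D (y - x)) (at 0 within {0..1})"
    by (simp add: has_field_derivative_def)
  then have lim: "((\<lambda>t. (h (g t) - h x) / t) \<longlongrightarrow> D (y - x)) (at 0 within {0..1})"
    by (simp add: has_field_derivative_iff g_def)
  have "\<forall>\<^sub>F t in at 0 within {0..1}. h y - h x \<le> (h (g t) - h x) / t"
    unfolding eventually_at_filter
  proof (intro always_eventually allI impI)
    fix t :: real assume t: "t \<noteq> 0" "t \<in> {0..1}"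
    then have "h (g t) \<ge> (1 - t) * h x + t * h y"
      using conc x y by (auto simp: g_eq concave_on_iff)
    then show "h y - h x \<le> (h (g t) - h x) / t"
      using t by (simp add: field_simps)
  qed
  moreover have "at (0::real) within {0..1} \<noteq> bot"
    by (simp add: at_within_Icc_at_right)
  ultimately have "h y - h x \<le> D (y - x)"
    using tendsto_lowerbound[OF lim] by blast
  then show ?thesis by simp
qed

lemma curvature_bound_step:
  assumes "curvature_bound h h' Q C" "x \<in> Q" "y \<in> Q" "0 \<le> a" "a \<le> 1" "linear (h' x)"
  shows "h (x + a *\<^sub>R (y - x)) \<ge> h x + a * fw_gap h' x y - 1 / 2 * C * a\<^sup>2"
  using assms unfolding curvature_bound_def fw_gap_def
  by (auto simp: linear_scale[OF assms(6)])

section \<open>Iterates and upper bounds along a run\<close>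

lemma fw_prestart_iterates_in:
  assumes "frank_wolfe_prestart h h' Q \<alpha> Binit Bo lam lamt B" "convex Q"
    and "\<And>i. 0 \<le> \<alpha> i" "\<And>i. \<alpha> i \<le> 1"
  shows "lam i \<in> Q" "lamt i \<in> Q"
proof -
  have lamt: "lamt j \<in> Q" for j
    using assms(1) by (auto simp: frank_wolfe_prestart_def is_arg_max_def)
  show "lamt i \<in> Q" by (rule lamt)
  show "lam i \<in> Q"
  proof (induction i)
    case 0
    then show ?case using assms(1) by (simp add: frank_wolfe_prestart_def)
  next
    case (Suc i)
    show ?case
    \<comment> \<open>The passage from index 0 to 1 is the pre-start step, which jumps to
      \<open>lamt 0\<close> whatever \<open>\<alpha> 0\<close> is.\<close>
    proof (cases "i = 0")
      case True
      then show ?thesis using assms(1) lamt by (simp add: frank_wolfe_prestart_def)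
    next
      case False
      then have "lam (Suc i) = lam i + \<alpha> i *\<^sub>R (lamt i - lam i)"
        using assms(1) by (simp add: frank_wolfe_prestart_def)
      also have "\<dots> = (1 - \<alpha> i) *\<^sub>R lam i + \<alpha> i *\<^sub>R lamt i"
        by (simp add: algebra_simps)
      finally show ?thesis
        using Suc lamt assms(2-4) by (auto simp: convex_alt)
    qed
  qed
qed

lemma fw_prestart_bound_le_wolfe:
  assumes "frank_wolfe_prestart h h' Q \<alpha> Binit Bo lam lamt B"
  shows "B i \<le> ereal (wolfe_bound h h' (lam i) (lamt i))"
  using assms by (cases "i = 0") (auto simp: frank_wolfe_prestart_def min_le_iff_disj)

lemma fw_prestart_bound_antimono:
  assumes "frank_wolfe_prestart h h' Q \<alpha> Binit Bo lam lamt B"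
  shows "antimono B"
proof (rule decseq_SucI)
  fix i
  have "B (Suc i) = Min {B (Suc i - 1), ereal (wolfe_bound h h' (lam (Suc i)) (lamt (Suc i))), Bo (Suc i)}"
    using assms unfolding frank_wolfe_prestart_def by (metis One_nat_def Suc_le_mono zero_le)
  then show "B (Suc i) \<le> B i" by simp
qed

text \<open>By concavity the linearization at \<open>x\<close> majorizes \<open>h\<close> on all of
  \<open>Q\<close>, so its maximum over \<open>Q\<close> does too.\<close>

lemma wolfe_bound_ge_opt_value:
  assumes "Q \<noteq> {}" "concave_on Q h" "x \<in> Q" "(h has_derivative h' x) (at x within Q)"
    and "is_arg_max (linearization h h' x) (\<lambda>x. x \<in> Q) xt"
  shows "opt_value h Q \<le> wolfe_bound h h' x xt"
  unfolding opt_value_def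
proof (rule cSUP_least)
  show "Q \<noteq> {}" by fact
  fix y assume y: "y \<in> Q"
  have "h y \<le> linearization h h' x y"
    using concave_on_has_derivative_le[OF assms(2,3) y assms(4)] by (simp add: linearization_def)
  also have "\<dots> \<le> linearization h h' x xt"
    using assms(5) y by (auto simp: is_arg_max_linorder)
  finally show "h y \<le> wolfe_bound h h' x xt" by (simp add: wolfe_bound_def)
qed

lemma fw_prestart_bound_ge_opt_value:
  assumes fw: "frank_wolfe_prestart h h' Q \<alpha> Binit Bo lam lamt B"
    and wolfe: "\<And>i. opt_value h Q \<le> wolfe_bound h h' (lam i) (lamt i)"
  shows "ereal (opt_value h Q) \<le> B i"
proof (induction i)
  case 0
  then show ?case using fw wolfe[of 0] by (simp add: frank_wolfe_prestart_def)
next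
  case (Suc i)
  have "B (Suc i) = Min {B (Suc i - 1), ereal (wolfe_bound h h' (lam (Suc i)) (lamt (Suc i))), Bo (Suc i)}"
    using fw unfolding frank_wolfe_prestart_def by (metis One_nat_def Suc_le_mono zero_le)
  then show ?case
    using Suc fw wolfe[of "Suc i"] by (simp add: frank_wolfe_prestart_def)
qed

section \<open>Scalar recursion, averaging and step-size estimates\<close>

text \<open>The map \<open>x\<close> to \<open>(1 - a) * x + c * a\<^sup>2\<close> fixes
  \<open>c * a\<close> and contracts distances to it by the factor \<open>1 - a\<close>. The bound
  is \<open>c * a + (1 - a) ^ k * (c - c * a)\<close>, its \<open>k\<close>-th iterate at
  \<open>c\<close>.\<close>

lemma fw_recursion_le:
  fixes e :: "nat \<Rightarrow> real"
  assumes "0 \<le> a" "a \<le> 1" "e 1 \<le> c"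
    and "\<And>i. 1 \<le> i \<Longrightarrow> i \<le> k \<Longrightarrow> e (Suc i) \<le> (1 - a) * e i + c * a\<^sup>2"
  shows "e (Suc k) \<le> c * ((1 - a) ^ k + a * (1 - (1 - a) ^ k))"
  using assms(4)
proof (induction k)
  case 0
  then show ?case using assms(3) by simp
next
  case (Suc k)
  have "e (Suc (Suc k)) \<le> (1 - a) * e (Suc k) + c * a\<^sup>2"
    by (rule Suc.prems) auto
  also have "\<dots> \<le> (1 - a) * (c * ((1 - a) ^ k + a * (1 - (1 - a) ^ k))) + c * a\<^sup>2"
    using Suc assms(2) by (intro add_right_mono mult_left_mono) auto
  also have "\<dots> = c * ((1 - a) ^ Suc k + a * (1 - (1 - a) ^ Suc k))"
    by (simp add: algebra_simps power2_eq_square)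
  finally show ?case .
qed

text \<open>Averaging over only the last \<open>n + 1\<close> indices bounds the minimum over the
  whole range. It is used with \<open>m = n = k\<close>.\<close>

lemma Min_mult_le_sum:
  fixes g :: "nat \<Rightarrow> real"
  shows "real (n + 1) * (MIN i\<in>{1..m + n + 1}. g i) \<le> (\<Sum>i=m+1..m+n+1. g i)"
proof -
  have "(\<Sum>i=m+1..m+n+1. (MIN i\<in>{1..m + n + 1}. g i)) \<le> (\<Sum>i=m+1..m+n+1. g i)"
    by (intro sum_mono Min_le) auto
  then show ?thesis by simp
qed

text \<open>With \<open>r\<close> the root, \<open>ln r = ln (k + 1) / k\<close>. Both logarithmic
  estimates come from \<open>ln x \<le> x - 1\<close>: at \<open>x = 1 / r\<close> it bounds
  \<open>a = 1 - 1 / r\<close>, and at \<open>x = r\<close> it bounds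
  \<open>1 / a = 1 + 1 / (r - 1)\<close>.\<close>

lemma one_minus_inverse_root_bounds:
  fixes k :: nat
  assumes k: "k \<ge> 1"
  defines "a \<equiv> 1 - 1 / root k (real k + 1)"
  shows "0 < a" "a < 1" "(1 - a) ^ k = 1 / (real k + 1)" "a \<le> ln (real k + 1) / k"
    "1 / a \<le> 1 + k / ln (real k + 1)"
proof -
  define r where "r = root k (real k + 1)"
  have r1: "r > 1" unfolding r_def using k by simp
  have a: "a = 1 - 1 / r" by (simp add: a_def r_def)
  show a0: "0 < a" "a < 1" using r1 by (auto simp: a)
  show "(1 - a) ^ k = 1 / (real k + 1)"
    using k by (simp add: a_def power_divide)
  have lnr: "ln r = ln (real k + 1) / k"
    unfolding r_def using k by (simp add: ln_root)
  have "ln (1 / r) \<le> 1 / r - 1" using r1 by (intro ln_le_minus_one) simp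
  then have "a \<le> ln r" using r1 by (simp add: a ln_div)
  then show "a \<le> ln (real k + 1) / k" using lnr by simp
  have lr: "0 < ln r" using r1 by simp
  have "ln r \<le> r - 1" using r1 by (intro ln_le_minus_one) simp
  have "1 / a = 1 + 1 / (r - 1)" using r1 by (simp add: a field_simps)
  also have "\<dots> \<le> 1 + 1 / ln r"
    using \<open>ln r \<le> r - 1\<close> lr by (simp add: frac_le)
  finally show "1 / a \<le> 1 + k / ln (real k + 1)" using lnr by simp
qed

text \<open>Numerical estimate for the FW gaps, with \<open>L\<close> in the role of
  \<open>ln (k + 1)\<close>. Inserting the bound on \<open>1 / a\<close> splits the first summand
  into \<open>1 / (k + 1)\<close> and a term that \<open>L \<ge> k / (k + 1)\<close> reduces to
  \<open>L / k\<close>; the second summand \<open>a\<close> contributes another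
  \<open>L / k\<close>.\<close>

lemma fw_gap_rate_le:
  fixes k L a :: real
  assumes k: "k \<ge> 1" and a: "0 < a" "a \<le> L / k" "1 / a \<le> 1 + k / L" and L: "L \<ge> k / (k + 1)"
  shows "(1 + k * a) / (k + 1) / ((k + 1) * a) + a \<le> (1 + 2 * L) / k"
proof -
  have L0: "L > 0" using k L by (smt (verit) divide_pos_pos)
  have "(1 + k * a) / (k + 1) / ((k + 1) * a) = (1 / a + k) / (k + 1)\<^sup>2"
    using k a by (simp add: field_simps power2_eq_square)
  also have "\<dots> \<le> (1 + k / L + k) / (k + 1)\<^sup>2"
    using a(3) k by (intro divide_right_mono) auto
  also have "\<dots> = (k + 1) / (k + 1)\<^sup>2 + k / L / (k + 1)\<^sup>2"
    by (simp add: add_divide_distrib)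
  also have "(k + 1) / (k + 1)\<^sup>2 = 1 / (k + 1)"
    using k by (simp add: power2_eq_square)
  also have "k / L / (k + 1)\<^sup>2 = (k / (k + 1))\<^sup>2 / (L * k)"
    using k by (simp add: power2_eq_square)
  also have "1 / (k + 1) + (k / (k + 1))\<^sup>2 / (L * k) \<le> 1 / k + L\<^sup>2 / (L * k)"
    using k L L0 by (intro add_mono divide_right_mono power_mono frac_le) auto
  also have "\<dots> = (1 + L) / k"
    using k L0 by (simp add: field_simps power2_eq_square)
  finally show ?thesis using a(2) k by (simp add: field_simps)
qed

theorem mainTheorem6:
  fixes h :: "'a::real_normed_vector \<Rightarrow> real"
    and h' :: "'a \<Rightarrow> 'a \<Rightarrow> real"
    and Q :: "'a set"
    and k :: nat
    and Binit :: ereal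
    and Bo B :: "nat \<Rightarrow> ereal"
    and lam lamt :: "nat \<Rightarrow> 'a"
  assumes "\<exists>S :: 'a set. finite S \<and> span S = UNIV"
    and "Q \<noteq> {}" and "convex Q" and "compact Q"
    and "concave_on Q h"
    and "\<And>x. x \<in> Q \<Longrightarrow> (h has_derivative h' x) (at x within Q)"
    and "finite_curvature h h' Q"
    and "k \<ge> 1"
    and "frank_wolfe_prestart h h' Q (\<lambda>i. 1 - 1 / root k (real k + 1)) Binit Bo lam lamt B"
  shows "B k - ereal (h (lam (k + 1)))
           \<le> ereal ((1 / 2 * curvature_const h h' Q * (1 + ln (real k + 1))) / real k)
       \<and> (MIN i\<in>{1..2 * k + 1}. fw_gap h' (lam i) (lamt i))
           \<le> (1 / 2 * curvature_const h h' Q * (1 + 2 * ln (real k + 1))) / real k"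
proof -
  note der = assms(6) and fw = assms(9)
  define a where "a = 1 - 1 / root k (real k + 1)"
  define L where "L = ln (real k + 1)"
  define C where "C = curvature_const h h' Q"
  define G where "G i = fw_gap h' (lam i) (lamt i)" for i
  note a = one_minus_inverse_root_bounds[OF assms(8), folded a_def L_def]
  note fw = fw[folded a_def]
  have k: "real k \<ge> 1" using assms(8) by simp
  have lin: "linear (h' x)" if "x \<in> Q" for x
    using has_derivative_linear[OF der[OF that]] .
  have cb: "curvature_bound h h' Q C"
    unfolding C_def using curvature_bound_curvature_const assms(2,7) lin by blast
  have inQ: "lam i \<in> Q" "lamt i \<in> Q" for i
    using fw_prestart_iterates_in[OF fw assms(3)] a by auto
  have cont: "continuous_on Q h"
    using der has_derivative_continuous continuous_on_eq_continuous_within by blast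
  note h_le_opt = opt_value_is_max(2)[OF assms(2,4) cont]

  have full_step: "h (lam 1) \<ge> h (lam 0) + G 0 - C / 2"
  proof -
    have "lam 1 = lam 0 + 1 *\<^sub>R (lamt 0 - lam 0)"
      using fw by (simp add: frank_wolfe_prestart_def)
    then show ?thesis
      using curvature_bound_step[OF cb inQ(1)[of 0] inQ(2)[of 0], of 1] lin inQ by (simp add: G_def)
  qed
  have step: "h (lam (Suc i)) \<ge> h (lam i) + a * G i - C / 2 * a\<^sup>2" if "i \<ge> 1" for i
  proof -
    have "lam (Suc i) = lam i + a *\<^sub>R (lamt i - lam i)"
      using fw that by (simp add: frank_wolfe_prestart_def)
    then show ?thesis
      using curvature_bound_step[OF cb inQ(1)[of i] inQ(2)[of i], of a] lin inQ a by (simp add: G_def)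
  qed
  \<comment> \<open>Taking both points of the curvature inequality equal leaves only
    \<open>0 \<ge> - C / 2\<close>.\<close>
  have C0: "C \<ge> 0"
    using curvature_bound_step[OF cb inQ(1)[of 0] inQ(1)[of 0], of 1] lin inQ
    by (simp add: fw_gap_def linear_0)

  have wolfe_eq: "wolfe_bound h h' (lam i) (lamt i) = h (lam i) + G i" for i
    by (simp add: wolfe_bound_def linearization_def G_def fw_gap_def)
  have "is_arg_max (linearization h h' (lam i)) (\<lambda>x. x \<in> Q) (lamt i)" for i
    using fw by (simp add: frank_wolfe_prestart_def)
  then have opt_le_B: "ereal (opt_value h Q) \<le> B i" for i
    using fw_prestart_bound_ge_opt_value[OF fw] wolfe_bound_ge_opt_value assms(2,5) inQ der by blast
  \<comment> \<open>\<open>B k\<close> lies between the optimal value and a Wolfe bound, hence is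
    finite even if \<open>Binit\<close> and all \<open>Bo i\<close> are infinite. From here on the
    argument is in the reals.\<close>
  obtain b where b: "B k = ereal b"
    using opt_le_B[of k] fw_prestart_bound_le_wolfe[OF fw, of k] by (cases "B k") auto
  have b_le: "b \<le> h (lam i) + G i" if "i \<le> k" for i
  proof -
    have "ereal b \<le> B i" using antimonoD[OF fw_prestart_bound_antimono[OF fw] that] b by simp
    also have "\<dots> \<le> ereal (h (lam i) + G i)"
      using fw_prestart_bound_le_wolfe[OF fw, of i] by (simp add: wolfe_eq)
    finally show ?thesis by simp
  qed

  have "b - h (lam (Suc k)) \<le> C / 2 * ((1 - a) ^ k + a * (1 - (1 - a) ^ k))"
  proof (rule fw_recursion_le[of a "\<lambda>i. b - h (lam i)" "C / 2" k])
    \<comment> \<open>The Wolfe bound of the pre-start step itself, index 0, is needed here: it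
      cancels \<open>h (lam 0) + G 0\<close> in \<open>full_step\<close>.\<close>
    show "b - h (lam 1) \<le> C / 2" using full_step b_le[of 0] by simp
    fix i assume i: "1 \<le> i" "i \<le> k"
    have "a * (b - h (lam i)) \<le> a * G i" using b_le[of i] i a by (intro mult_left_mono) auto
    then show "b - h (lam (Suc i)) \<le> (1 - a) * (b - h (lam i)) + C / 2 * a\<^sup>2"
      using step[of i] i by (simp add: algebra_simps)
  qed (use a in auto)
  also have "(1 - a) ^ k + a * (1 - (1 - a) ^ k) = (1 + k * a) / (k + 1)"
    unfolding a(3) by (simp add: field_simps)
  finally have e: "b - h (lam (Suc k)) \<le> C / 2 * ((1 + k * a) / (k + 1))" .

  have "L \<ge> 0" by (simp add: L_def)
  then have "(1 + k * a) / (k + 1) \<le> (1 + L) / k"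
    using a k by (intro frac_le) (auto simp: field_simps)
  then have "C / 2 * ((1 + k * a) / (k + 1)) \<le> C / 2 * ((1 + L) / k)"
    using C0 by (intro mult_left_mono) auto
  then have first: "b - h (lam (k + 1)) \<le> 1 / 2 * C * (1 + L) / k"
    using e by simp

  \<comment> \<open>Beyond iteration \<open>k\<close> the bound \<open>b_le\<close> no longer
    applies, so the gaps are kept and the increases of \<open>h\<close> telescoped;
    \<open>n = k + 1\<close> reaches iteration \<open>2 * k + 1\<close>.\<close>
  have "h (lam (Suc (k + n))) \<ge> h (lam (Suc k)) + (\<Sum>i=k+1..k+n. a * G i - C / 2 * a\<^sup>2)" for n
  proof (induction n)
    case (Suc n)
    then show ?case using step[of "Suc (k + n)"] by simp
  qed simp
  from this[of "k + 1"]
  have "a * (\<Sum>i=k+1..k+k+1. G i) - (k + 1) * (C / 2 * a\<^sup>2) \<le> h (lam (Suc (k + (k + 1)))) - h (lam (Suc k))"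
    by (simp add: sum_subtractf sum_distrib_left algebra_simps)
  \<comment> \<open>The earlier bound \<open>B k\<close> still dominates the optimal value, hence
    \<open>h\<close> at every later iterate. The total increase is therefore at most the quantity
    estimated in \<open>e\<close>.\<close>
  also have "h (lam (Suc (k + (k + 1)))) \<le> b"
    using h_le_opt[OF inQ(1)] opt_le_B[of k] b by (metis ereal_less_eq(3) order_trans)
  finally have sumG: "a * (\<Sum>i=k+1..k+k+1. G i) \<le> C / 2 * ((1 + k * a) / (k + 1)) + (k + 1) * (C / 2 * a\<^sup>2)"
    using e by simp
  define M where "M = (MIN i\<in>{1..2 * k + 1}. G i)"
  have "a * (real (k + 1) * M) \<le> a * (\<Sum>i=k+1..k+k+1. G i)"
    using Min_mult_le_sum[of k G k] a by (intro mult_left_mono) (auto simp: M_def mult_2)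
  then have "((k + 1) * a) * M \<le> C / 2 * ((1 + k * a) / (k + 1)) + (k + 1) * (C / 2 * a\<^sup>2)"
    using sumG by (simp add: mult_ac)
  then have "M \<le> (C / 2 * ((1 + k * a) / (k + 1)) + (k + 1) * (C / 2 * a\<^sup>2)) / ((k + 1) * a)"
    using a by (simp add: pos_le_divide_eq mult_ac)
  also have "\<dots> = C / 2 * ((1 + k * a) / (k + 1) / ((k + 1) * a) + a)"
  proof -
    \<comment> \<open>Here \<open>c\<close> stands for \<open>C / 2\<close>, \<open>s\<close> for
      \<open>k + 1\<close> and \<open>Y\<close> for the quotient
      \<open>(1 + k * a) / (k + 1)\<close>, which stays unexpanded.\<close>
    have "(c * Y + s * (c * a\<^sup>2)) / (s * a) = c * (Y / (s * a) + a)" if "s > 0" for c Y s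
      using that a(1) by (simp add: field_simps power2_eq_square)
    then show ?thesis by this simp
  qed
  also have "\<dots> \<le> C / 2 * ((1 + 2 * L) / k)"
  proof (rule mult_left_mono)
    \<comment> \<open>At the reciprocal, the upper bound on \<open>ln\<close> becomes a lower bound
      on \<open>L\<close>.\<close>
    have "ln (1 / (real k + 1)) \<le> 1 / (real k + 1) - 1" by (intro ln_le_minus_one) simp
    then have "real k / (real k + 1) \<le> L" by (simp add: L_def ln_div field_simps)
    from fw_gap_rate_le[OF k a(1,4,5) this]
    show "(1 + k * a) / (k + 1) / ((k + 1) * a) + a \<le> (1 + 2 * L) / k"
      by (simp add: add.commute)
  qed (use C0 in simp)
  finally have second: "M \<le> 1 / 2 * C * (1 + 2 * L) / k" by simp
  show ?thesis
    using first second by (simp add: b C_def L_def M_def G_def)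
qed

end
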